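(* Let $\Omega$ be a connected weighted simplicial complex on $[n]$, let the finite group $G$ act on $\Omega$, and let $p\in\mathcal P=\mathbb R[\mathbf x^{[0]},\dots,\mathbf x^{[n]}]$ be a $G$-invariant polynomial. If $G$ acts freely on $\Omega$, then $p$ has an $(\Omega,G)$-decomposition, i.e. $\operatorname{rank}_{(\Omega,G)}(p)<\infty$. Moreover, given a decomposition of the form $$p=\sum_{j=1}^r p^{[0]}_j(\mathbf x^{[0]})\cdots p^{[n]}_j(\mathbf x^{[n]}),\qquad p_j^{[i]}\in\mathbb R[\mathbf x^{[i]}],$$ an $(\Omega,G)$-decomposition of $p$ can be obtained by using only nonnegative multiples of the $p_j^{[i]}$ as local polynomials at each site $i$.
   Context: $[n]=\{0,\dots,n\}$ and $\mathbb N=\{0,1,2,\dots\}$. A weighted simplicial complex on $[n]$ is a map $\Omega$ from the power set of $[n]$ to $\mathbb N$ such that $\Omega(S_1)$ divides $\Omega(S_2)$ whenever $S_1\subseteq S_2$; it is always assumed that $\Omega(\{i\})\neq 0$ for all $i\in[n]$. Sets $S$ with $\Omega(S)\ne0$ are called simplices, inclusion-maximal simplices are called facets, and $\mathcal F$ is the set of facets. $\widetilde{\mathcal F}$ is the multiset containing each facet $F$ exactly $\Omega(F)$ times (copies are regarded as distinct elements), $c:\widetilde{\mathcal F}\to\mathcal F$ maps each copy to its underlying facet, and $\widetilde{\mathcal F}_i=\{\mathfrak f\in\widetilde{\mathcal F}: i\in c(\mathfrak f)\}$. Two vertices are neighbours if some facet contains both; $\Omega$ is connected if any two vertices are joined by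 a chain of consecutive neighbours. An action of a finite group $G$ on $\Omega$ consists of an action of $G$ on $[n]$ with $\Omega(gS)=\Omega(S)$ for all $g\in G$, $S\subseteq[n]$, together with an action of $G$ on the set $\widetilde{\mathcal F}$ such that $c(g\mathfrak f)=g\,c(\mathfrak f)$. The action on $\Omega$ is called free if the action on $\widetilde{\mathcal F}$ is free (all stabilizers are trivial). For each $i\in[n]$ (also called a site), $\mathbf x^{[i]}=(x^{[i]}_1,\dots,x^{[i]}_{m_i})$ is a collection of variables, with $m_i=m_{gi}$ for all $g\in G$. If $m_i=m_j$ and $f\in\mathbb R[\mathbf x^{[i]}]$, then $f(\mathbf x^{[j]})$ denotes the polynomial obtained by substituting $\mathbf x^{[j]}$ for $\mathbf x^{[i]}$; the spaces $\mathbb R[\mathbf x^{[i]}]$ and $\mathbb R[\mathbf x^{[j]}]$ are identified in this way. $G$ acts on $\mathcal P$ by $(gp)(\mathbf x^{[0]},\dots,\mathbf x^{[n]})=p(\mathbf x^{[g0]},\dots,\mathbf x^{[gn]})$, and $p$ is $G$-invariant if $gp=p$ for all $g\in G$. For sets $A,\mathcal I$, $\mathcal I^A$ denotes the set of functions $A\to\mathcal I$. For $\alpha\in\mathcal I^{\widetilde{\mathcal F}}$, $\alpha_{|_i}$ is its restriction to $\widetilde{\mathcal F}_i$. For $\beta\in\mathcal I^{\widetilde{\mathcal F}_i}$ and $g\in G$, ${}^g\beta\in\mathcal I^{\widetilde{\mathcal F}_{gi}}$ is defined by $({}^g\beta)(\mathfrak f)=\beta(g^{-1}\mathfrak f)$.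 An $(\Omega,G)$-decomposition of $p$ consists of a finite index set $\mathcal I$ and local polynomials $p^{[i]}_\beta\in\mathbb R[\mathbf x^{[i]}]$ (at site $i$) for $i\in[n]$, $\beta\in\mathcal I^{\widetilde{\mathcal F}_i}$, such that $$p=\sum_{\alpha\in\mathcal I^{\widetilde{\mathcal F}}}p^{[0]}_{\alpha_{|_0}}(\mathbf x^{[0]})\cdots p^{[n]}_{\alpha_{|_n}}(\mathbf x^{[n]})$$ and $p^{[i]}_\beta(\mathbf x^{[i]})=p^{[gi]}_{{}^g\beta}(\mathbf x^{[i]})$ for all $i\in[n]$, $g\in G$, $\beta\in\mathcal I^{\widetilde{\mathcal F}_i}$. $\operatorname{rank}_{(\Omega,G)}(p)$ is the minimal cardinality of $\mathcal I$ among all $(\Omega,G)$-decompositions of $p$ ($\infty$ if there is none).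
   Formalization: The local polynomials at site i are nonnegative multiples of p_j^{[gi]}(x^{[i]}) for some g in G, not only of p_j^{[i]}; the literal claim fails for a double edge with C_2 swapping sites and copies, p=1+x0x1=(1+x0)·1+x0(x1−1). *)

theory Defs
  imports
    "HOL-Algebra.Group_Action"
    "HOL-Library.Poly_Mapping"
    "HOL-Library.Extended_Nat"
begin

text \<open>Only the values of \<open>\<Omega>\<close> on subsets of \<open>{..n}\<close> are ever used.\<close>

locale weighted_complex =
  fixes n :: nat and \<Omega> :: "nat set \<Rightarrow> nat"
  assumes weight_dvd: "\<And>S T. S \<subseteq> T \<Longrightarrow> T \<subseteq> {..n} \<Longrightarrow> \<Omega> S dvd \<Omega> T"
    and weight_vertex: "\<And>i. i \<le> n \<Longrightarrow> \<Omega> {i} \<noteq> 0"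

definition simplices :: "nat \<Rightarrow> (nat set \<Rightarrow> nat) \<Rightarrow> nat set set" where
  "simplices n \<Omega> = {S. S \<subseteq> {..n} \<and> \<Omega> S \<noteq> 0}"

definition facets :: "nat \<Rightarrow> (nat set \<Rightarrow> nat) \<Rightarrow> nat set set" where
  "facets n \<Omega> = {F \<in> simplices n \<Omega>. \<forall>S \<in> simplices n \<Omega>. F \<subseteq> S \<longrightarrow> S = F}"

text \<open>
  The multiset of facets, with copies regarded as distinct elements: the copies of \<open>F\<close> are
  the pairs \<open>(F, k)\<close> with \<open>k < \<Omega> F\<close>. The map to the underlying facet is \<open>fst\<close>.
\<close>

definition facet_copies :: "nat \<Rightarrow> (nat set \<Rightarrow> nat) \<Rightarrow> (nat set \<times> nat) set" where
  "facet_copies n \<Omega> = (SIGMA F : facets n \<Omega>. {..<\<Omega> F})"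

definition facet_copies_at :: "nat \<Rightarrow> (nat set \<Rightarrow> nat) \<Rightarrow> nat \<Rightarrow> (nat set \<times> nat) set" where
  "facet_copies_at n \<Omega> i = {f \<in> facet_copies n \<Omega>. i \<in> fst f}"

definition neighbours :: "nat \<Rightarrow> (nat set \<Rightarrow> nat) \<Rightarrow> nat \<Rightarrow> nat \<Rightarrow> bool" where
  "neighbours n \<Omega> i j \<longleftrightarrow> (\<exists>F \<in> facets n \<Omega>. i \<in> F \<and> j \<in> F)"

definition connected_complex :: "nat \<Rightarrow> (nat set \<Rightarrow> nat) \<Rightarrow> bool" where
  "connected_complex n \<Omega> \<longleftrightarrow> (\<forall>i \<le> n. \<forall>j \<le> n. (neighbours n \<Omega>)\<^sup>*\<^sup>* i j)"

text \<open>\<open>\<phi>\<close> is the action on the vertices, \<open>\<psi>\<close> the action on the copies of the facets.\<close>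

locale complex_action =
  weighted_complex n \<Omega> +
  vertex: group_action G "{..n}" \<phi> +
  facet: group_action G "facet_copies n \<Omega>" \<psi>
  for n :: nat and \<Omega> :: "nat set \<Rightarrow> nat" and G :: "('g, 'b) monoid_scheme" (structure)
    and \<phi> :: "'g \<Rightarrow> nat \<Rightarrow> nat" and \<psi> :: "'g \<Rightarrow> nat set \<times> nat \<Rightarrow> nat set \<times> nat" +
  assumes finite_group: "finite (carrier G)"
    and weight_invariant: "\<And>g S. g \<in> carrier G \<Longrightarrow> S \<subseteq> {..n} \<Longrightarrow> \<Omega> (\<phi> g ` S) = \<Omega> S"
    and fst_equivariant:
      "\<And>g f. g \<in> carrier G \<Longrightarrow> f \<in> facet_copies n \<Omega> \<Longrightarrow> fst (\<psi> g f) = \<phi> g ` fst f"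

definition free_action ::
    "nat \<Rightarrow> (nat set \<Rightarrow> nat) \<Rightarrow> ('g, 'b) monoid_scheme \<Rightarrow>
     ('g \<Rightarrow> nat set \<times> nat \<Rightarrow> nat set \<times> nat) \<Rightarrow> bool" where
  "free_action n \<Omega> G \<psi> \<longleftrightarrow> (\<forall>f \<in> facet_copies n \<Omega>. stabilizer G \<psi> f = {\<one>\<^bsub>G\<^esub>})"

text \<open>
  Monomials are finitely supported exponent functions. Multiplication is the convolution product
  of \<^theory>\<open>HOL-Library.Poly_Mapping\<close>.
\<close>

type_synonym 'v mpoly = "('v \<Rightarrow>\<^sub>0 nat) \<Rightarrow>\<^sub>0 real"

definition Const :: "real \<Rightarrow> 'v mpoly" where
  "Const c = Poly_Mapping.single 0 c"

definition polys_in :: "'v set \<Rightarrow> 'v mpoly set" where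
  "polys_in V = {p. \<forall>t \<in> Poly_Mapping.keys p. Poly_Mapping.keys t \<subseteq> V}"

text \<open>Substitution of the variable \<open>f v\<close> for each variable \<open>v\<close>.\<close>

definition rename_monom :: "('v \<Rightarrow> 'w) \<Rightarrow> ('v \<Rightarrow>\<^sub>0 nat) \<Rightarrow> 'w \<Rightarrow>\<^sub>0 nat" where
  "rename_monom f t =
     (\<Sum>v \<in> Poly_Mapping.keys t. Poly_Mapping.single (f v) (Poly_Mapping.lookup t v))"

definition rename :: "('v \<Rightarrow> 'w) \<Rightarrow> 'v mpoly \<Rightarrow> 'w mpoly" where
  "rename f p =
     (\<Sum>t \<in> Poly_Mapping.keys p. Poly_Mapping.single (rename_monom f t) (Poly_Mapping.lookup p t))"

text \<open>The pair \<open>(i, k)\<close> is the \<open>k\<close>-th variable of site \<open>i\<close>, where \<open>1 \<le> k \<le> m i\<close>.\<close>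

type_synonym site_poly = "(nat \<times> nat) mpoly"

definition local_polys :: "(nat \<Rightarrow> nat) \<Rightarrow> nat \<Rightarrow> site_poly set" where
  "local_polys m i = polys_in ({i} \<times> {1..m i})"

definition global_polys :: "nat \<Rightarrow> (nat \<Rightarrow> nat) \<Rightarrow> site_poly set" where
  "global_polys n m = polys_in (SIGMA i : {..n}. {1..m i})"

text \<open>
  For \<open>f\<close> a local polynomial at some site with as many variables as site \<open>j\<close>, \<open>at_site j f\<close> is
  the polynomial \<open>f(\<^bold>x\<^sup>[\<^sup>j\<^sup>])\<close>.
\<close>

definition at_site :: "nat \<Rightarrow> site_poly \<Rightarrow> site_poly" where
  "at_site j f = rename (\<lambda>(i, k). (j, k)) f"

definition poly_act :: "('g \<Rightarrow> nat \<Rightarrow> nat) \<Rightarrow> 'g \<Rightarrow> site_poly \<Rightarrow> site_poly" where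
  "poly_act \<phi> g p = rename (\<lambda>(i, k). (\<phi> g i, k)) p"

definition invariant_poly ::
    "('g, 'b) monoid_scheme \<Rightarrow> ('g \<Rightarrow> nat \<Rightarrow> nat) \<Rightarrow> site_poly \<Rightarrow> bool" where
  "invariant_poly G \<phi> p \<longleftrightarrow> (\<forall>g \<in> carrier G. poly_act \<phi> g p = p)"

text \<open>
  Functions on facet copies are represented extensionally, so the translate of a
  \<open>\<beta>\<close> defined on the facet copies at \<open>i\<close> is restricted to the facet copies at \<open>\<phi> g i\<close>.
\<close>

definition translate ::
    "nat \<Rightarrow> (nat set \<Rightarrow> nat) \<Rightarrow> ('g, 'b) monoid_scheme \<Rightarrow> ('g \<Rightarrow> nat \<Rightarrow> nat) \<Rightarrow>
     ('g \<Rightarrow> nat set \<times> nat \<Rightarrow> nat set \<times> nat) \<Rightarrow> nat \<Rightarrow> 'g \<Rightarrow>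
     (nat set \<times> nat \<Rightarrow> 'i) \<Rightarrow> nat set \<times> nat \<Rightarrow> 'i" where
  "translate n \<Omega> G \<phi> \<psi> i g \<beta> =
     restrict (\<lambda>f. \<beta> (\<psi> (inv\<^bsub>G\<^esub> g) f)) (facet_copies_at n \<Omega> (\<phi> g i))"

definition invariant_decomposition ::
    "nat \<Rightarrow> (nat set \<Rightarrow> nat) \<Rightarrow> ('g, 'b) monoid_scheme \<Rightarrow> ('g \<Rightarrow> nat \<Rightarrow> nat) \<Rightarrow>
     ('g \<Rightarrow> nat set \<times> nat \<Rightarrow> nat set \<times> nat) \<Rightarrow> (nat \<Rightarrow> nat) \<Rightarrow> site_poly \<Rightarrow>
     'i set \<Rightarrow> (nat \<Rightarrow> (nat set \<times> nat \<Rightarrow> 'i) \<Rightarrow> site_poly) \<Rightarrow> bool" where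
  "invariant_decomposition n \<Omega> G \<phi> \<psi> m p I q \<longleftrightarrow>
     finite I \<and>
     (\<forall>i \<le> n. \<forall>\<beta> \<in> facet_copies_at n \<Omega> i \<rightarrow>\<^sub>E I. q i \<beta> \<in> local_polys m i) \<and>
     p = (\<Sum>\<alpha> \<in> facet_copies n \<Omega> \<rightarrow>\<^sub>E I. \<Prod>i\<le>n. q i (restrict \<alpha> (facet_copies_at n \<Omega> i))) \<and>
     (\<forall>i \<le> n. \<forall>g \<in> carrier G. \<forall>\<beta> \<in> facet_copies_at n \<Omega> i \<rightarrow>\<^sub>E I.
        q i \<beta> = at_site i (q (\<phi> g i) (translate n \<Omega> G \<phi> \<psi> i g \<beta>)))"

text \<open>
  Finite index sets may be taken to be sets of natural numbers. The infimum of the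
  empty set is \<open>\<infinity>\<close>.
\<close>

definition decomposition_rank ::
    "nat \<Rightarrow> (nat set \<Rightarrow> nat) \<Rightarrow> ('g, 'b) monoid_scheme \<Rightarrow> ('g \<Rightarrow> nat \<Rightarrow> nat) \<Rightarrow>
     ('g \<Rightarrow> nat set \<times> nat \<Rightarrow> nat set \<times> nat) \<Rightarrow> (nat \<Rightarrow> nat) \<Rightarrow> site_poly \<Rightarrow> enat" where
  "decomposition_rank n \<Omega> G \<phi> \<psi> m p =
     Inf {enat (card I) | (I :: nat set) q. invariant_decomposition n \<Omega> G \<phi> \<psi> m p I q}"

end

theory Submission
  imports Defs
begin

text \<open>
  Choosing a representative in every orbit of the free action on the copies of facets gives an
  equivariant map \<open>z\<close> from the copies to \<open>G\<close>. Indices are (codes of) pairs \<open>(w, j)\<close> of a group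
  element and a summand. At site \<open>i\<close>, a labelling \<open>\<beta>\<close> gets a nonzero polynomial only if
  \<open>\<beta> f = (w * z f, j)\<close> for all copies \<open>f\<close> at \<open>i\<close> and some fixed \<open>(w, j)\<close>; this polynomial is the
  multiple by \<open>|G|\<close> to the power \<open>-1/(n+1)\<close> of the \<open>j\<close>-th one of site \<open>w i\<close>, moved to site \<open>i\<close>.
  Translating \<open>\<beta>\<close> by \<open>g\<close> replaces \<open>w\<close> by \<open>w g\<^sup>-\<^sup>1\<close> and \<open>i\<close> by \<open>g i\<close>, so \<open>w i\<close> does not change.
  By connectedness a global labelling contributes only if the same \<open>(w, j)\<close> occurs at all sites,
  so the total is the average over \<open>w\<close> of the translates of \<open>p\<close> by \<open>w\<^sup>-\<^sup>1\<close>, which is \<open>p\<close>.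
\<close>

section \<open>Monomial expansions and renaming of variables\<close>

lemma poly_mapping_eq_sum_singles:
  "p = (\<Sum>t \<in> Poly_Mapping.keys p. Poly_Mapping.single t (Poly_Mapping.lookup p t))"
  by (rule poly_mapping_eqI)
    (simp add: lookup_sum lookup_single when_def in_keys_iff)

lemma prod_single:
  "finite A \<Longrightarrow> (\<Prod>i\<in>A. Poly_Mapping.single (t i) (c i)) =
    Poly_Mapping.single (\<Sum>i\<in>A. t i) (\<Prod>i\<in>A. c i :: 'a :: comm_semiring_1)"
  by (induction A rule: finite_induct) (simp_all add: mult_single)

lemma rename_monom_zero [simp]: "rename_monom f 0 = 0"
  by (simp add: rename_monom_def)

text \<open>Terms with exponent zero vanish and \<open>single\<close> is additive in the exponent,
  so variables that collide under \<open>f\<close> do no harm.\<close>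

lemma rename_monom_add: "rename_monom f (s + t) = rename_monom f s + rename_monom f t"
  unfolding rename_monom_def
  by (rule setsum_keys_plus_distrib) (simp_all add: single_add)

lemma rename_monom_single [simp]:
  "rename_monom f (Poly_Mapping.single v k) = Poly_Mapping.single (f v) k"
  by (simp add: rename_monom_def)

lemma rename_monom_sum: "rename_monom f (\<Sum>i\<in>A. t i) = (\<Sum>i\<in>A. rename_monom f (t i))"
  by (induction A rule: infinite_finite_induct) (simp_all add: rename_monom_add)

lemma rename_monom_rename_monom:
  "rename_monom f (rename_monom g t) = rename_monom (f \<circ> g) t"
  by (subst (2) rename_monom_def) (simp add: rename_monom_sum, simp add: rename_monom_def)

lemma keys_sum_subset:
  "Poly_Mapping.keys (\<Sum>i\<in>A. p i) \<subseteq> (\<Union>i\<in>A. Poly_Mapping.keys (p i))"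
proof (induction A rule: infinite_finite_induct)
  case (insert a A)
  then show ?case
    using keys_add[of "p a" "\<Sum>i\<in>A. p i"] by auto
qed auto

lemma keys_rename_monom: "Poly_Mapping.keys (rename_monom f t) \<subseteq> f ` Poly_Mapping.keys t"
  unfolding rename_monom_def by (rule order.trans[OF keys_sum_subset]) (auto split: if_splits)

lemma rename_zero [simp]: "rename f 0 = 0"
  by (simp add: rename_def)

lemma rename_add: "rename f (p + q) = rename f p + rename f q"
  unfolding rename_def
  by (rule setsum_keys_plus_distrib) (simp_all add: single_add)

lemma rename_single [simp]:
  "rename f (Poly_Mapping.single t c) = Poly_Mapping.single (rename_monom f t) c"
  by (simp add: rename_def)

lemma rename_sum: "rename f (\<Sum>i\<in>A. p i) = (\<Sum>i\<in>A. rename f (p i))"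
  by (induction A rule: infinite_finite_induct) (simp_all add: rename_add)

lemma rename_rename: "rename f (rename g p) = rename (f \<circ> g) p"
  by (subst (2) rename_def) (simp add: rename_sum rename_monom_rename_monom, simp add: rename_def)

lemma rename_Const [simp]: "rename f (Const c) = Const c"
  by (simp add: Const_def)

lemma rename_one [simp]: "rename f 1 = 1"
  using rename_Const[of f 1] by (simp add: Const_def)

text \<open>Since \<open>rename\<close> is additive, expanding both factors into monomials reduces
  this to \<open>rename_monom_add\<close>.\<close>

lemma rename_mult: "rename f (p * q) = rename f p * rename f q"
proof -
  have "rename f (p * q) =
    (\<Sum>s\<in>Poly_Mapping.keys p. \<Sum>t\<in>Poly_Mapping.keys q.
      Poly_Mapping.single (rename_monom f s + rename_monom f t)
        (Poly_Mapping.lookup p s * Poly_Mapping.lookup q t))"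
    by (subst poly_mapping_eq_sum_singles[of p], subst poly_mapping_eq_sum_singles[of q])
      (simp add: sum_product mult_single rename_sum rename_monom_add)
  also have "\<dots> = rename f p * rename f q"
    by (simp add: rename_def sum_product mult_single)
  finally show ?thesis .
qed

lemma rename_prod: "rename f (\<Prod>i\<in>A. p i) = (\<Prod>i\<in>A. rename f (p i))"
  by (induction A rule: infinite_finite_induct) (simp_all add: rename_mult)

lemma rename_cong:
  assumes "p \<in> polys_in V" "\<And>v. v \<in> V \<Longrightarrow> f v = g v"
  shows "rename f p = rename g p"
proof -
  have "rename_monom f t = rename_monom g t" if "t \<in> Poly_Mapping.keys p" for t
    unfolding rename_monom_def using assms that
    by (intro sum.cong) (auto simp: polys_in_def subset_iff)
  then show ?thesis
    unfolding rename_def by (intro sum.cong) auto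
qed

lemma polys_in_zero [simp]: "0 \<in> polys_in V"
  by (simp add: polys_in_def)

lemma polys_in_Const: "Const c \<in> polys_in V"
  by (auto simp: polys_in_def Const_def split: if_splits)

lemma polys_in_mult:
  assumes "p \<in> polys_in V" "q \<in> polys_in V"
  shows "p * q \<in> polys_in V"
  unfolding polys_in_def
proof (intro CollectI ballI)
  fix t assume "t \<in> Poly_Mapping.keys (p * q)"
  then obtain a b where "a \<in> Poly_Mapping.keys p" "b \<in> Poly_Mapping.keys q" "t = a + b"
    using keys_mult[of p q] by blast
  then show "Poly_Mapping.keys t \<subseteq> V"
    using assms keys_add[of a b] by (fastforce simp: polys_in_def)
qed

lemma polys_in_rename:
  assumes "p \<in> polys_in V" "f ` V \<subseteq> W"
  shows "rename f p \<in> polys_in W"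
  unfolding polys_in_def
proof (intro CollectI ballI)
  fix t assume "t \<in> Poly_Mapping.keys (rename f p)"
  then obtain s where s: "s \<in> Poly_Mapping.keys p" "t = rename_monom f s"
    unfolding rename_def by (auto dest!: subsetD[OF keys_sum_subset] split: if_splits)
  then show "Poly_Mapping.keys t \<subseteq> W"
    using assms keys_rename_monom[of f s] by (fastforce simp: polys_in_def)
qed

section \<open>Moving polynomials between sites, and splitting a polynomial by sites\<close>

lemma at_site_zero [simp]: "at_site i 0 = 0"
  by (simp add: at_site_def)

lemma at_site_Const_mult: "at_site i (Const c * p) = Const c * at_site i p"
  by (simp add: at_site_def rename_mult)

lemma at_site_at_site: "at_site i (at_site j p) = at_site i p"
proof -
  have "(\<lambda>(a, k). (i, k)) \<circ> (\<lambda>(a, k). (j, k)) = (\<lambda>(a :: nat, k :: nat). (i, k))" by auto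
  then show ?thesis by (simp add: at_site_def rename_rename)
qed

lemma at_site_local:
  assumes "p \<in> local_polys m i" "m i = m j"
  shows "at_site j p \<in> local_polys m j"
  using assms unfolding local_polys_def at_site_def by (auto intro!: polys_in_rename)

lemma Const_mult: "Const a * Const b = Const (a * b)"
  by (simp add: Const_def mult_single)

lemma Const_one [simp]: "Const 1 = 1"
  by (simp add: Const_def)

lemma Const_power: "Const a ^ k = Const (a ^ k)"
  by (induction k) (simp_all add: Const_mult)

lemma of_nat_eq_Const: "of_nat k = Const (real k)"
  by (simp add: Const_def)

text \<open>Only variables of site \<open>i\<close> occur in \<open>p\<close>, and on these the two
  substitutions agree.\<close>

lemma poly_act_local:
  assumes "p \<in> local_polys m i"
  shows "poly_act \<phi> g p = at_site (\<phi> g i) p"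
  using assms unfolding poly_act_def at_site_def local_polys_def by (auto intro: rename_cong)

text \<open>Every variable of \<open>p\<close> belongs to exactly one site up to \<open>n\<close>,
  so each monomial is the product of its parts at the sites. There is one summand for each
  monomial.\<close>

lemma global_poly_sum_of_products:
  assumes "p \<in> global_polys n m"
  obtains r :: nat and f :: "nat \<Rightarrow> nat \<Rightarrow> site_poly"
  where "\<And>i j. i \<le> n \<Longrightarrow> f i j \<in> local_polys m i"
    and "p = (\<Sum>j = 1..r. \<Prod>i\<le>n. f i j)"
proof -
  let ?K = "Poly_Mapping.keys p"
  obtain e where e: "bij_betw e {1..card ?K} ?K"
    using ex_bij_betw_nat_finite_1[of ?K] by auto
  define part :: "nat \<Rightarrow> (nat \<times> nat \<Rightarrow>\<^sub>0 nat) \<Rightarrow> nat \<times> nat \<Rightarrow>\<^sub>0 nat" where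
    "part i t = (\<Sum>v \<in> {v \<in> Poly_Mapping.keys t. fst v = i}.
       Poly_Mapping.single v (Poly_Mapping.lookup t v))" for i t
  \<comment> \<open>The whole coefficient is put at site 0, so that the product over the sites
    contains it exactly once.\<close>
  define coef where
    "coef i t = (if i = 0 then Poly_Mapping.lookup p t else 1)" for i :: nat and t
  \<comment> \<open>Outside \<open>{1..card ?K}\<close> nothing is known about \<open>e j\<close>;
    the default 0 makes \<open>f i j\<close> local for every \<open>j\<close>.\<close>
  define f where "f i j = (if e j \<in> ?K then Poly_Mapping.single (part i (e j)) (coef i (e j)) else 0)"
    for i j
  have part_keys: "Poly_Mapping.keys (part i t) \<subseteq> {v \<in> Poly_Mapping.keys t. fst v = i}" for i t
    unfolding part_def by (rule order.trans[OF keys_sum_subset]) (auto split: if_splits)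
  have local: "f i j \<in> local_polys m i" for i j
    using assms part_keys[of i "e j"]
    by (fastforce simp: f_def local_polys_def global_polys_def polys_in_def)
  have "(\<Sum>i\<le>n. part i t) = t" if "t \<in> ?K" for t
  proof -
    have "(\<Sum>i\<le>n. part i t) =
      (\<Sum>v\<in>Poly_Mapping.keys t. Poly_Mapping.single v (Poly_Mapping.lookup t v))"
      unfolding part_def using assms that
      by (intro sum.group) (fastforce simp: global_polys_def polys_in_def)+
    then show ?thesis
      by (simp only: poly_mapping_eq_sum_singles[symmetric])
  qed
  moreover have "(\<Prod>i\<le>n. coef i t) = Poly_Mapping.lookup p t" for t
    by (simp add: coef_def prod.delta)
  ultimately have "(\<Prod>i\<le>n. f i j) = Poly_Mapping.single (e j) (Poly_Mapping.lookup p (e j))"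
    if "j \<in> {1..card ?K}" for j
    using that bij_betwE[OF e] by (simp add: f_def prod_single)
  then have "(\<Sum>j = 1..card ?K. \<Prod>i\<le>n. f i j) =
    (\<Sum>j = 1..card ?K. Poly_Mapping.single (e j) (Poly_Mapping.lookup p (e j)))"
    by simp
  also have "\<dots> = p"
    using sum.reindex_bij_betw[OF e, of "\<lambda>t. Poly_Mapping.single t (Poly_Mapping.lookup p t)"]
    by (simp only: poly_mapping_eq_sum_singles[symmetric])
  finally show thesis
    using that local by metis
qed

section \<open>Equivariant maps from a free action to the group\<close>

lemma (in group_action) free_equivariant_map:
  assumes free: "\<And>x. x \<in> E \<Longrightarrow> stabilizer G \<phi> x = {\<one>}"
  obtains z where "\<And>x. x \<in> E \<Longrightarrow> z x \<in> carrier G"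
    and "\<And>g x. g \<in> carrier G \<Longrightarrow> x \<in> E \<Longrightarrow> z (\<phi> g x) = g \<otimes> z x"
proof -
  interpret group G
    using group_hom group_hom.axioms(1) by auto
  \<comment> \<open>Freeness: two group elements that agree at one point are equal, because
    \<open>inv h \<otimes> g\<close> stabilizes it.\<close>
  have unique: "g = h" if "g \<in> carrier G" "h \<in> carrier G" "y \<in> E" "\<phi> g y = \<phi> h y" for g h y
  proof -
    have "\<phi> (inv h \<otimes> g) y = y"
      using that orbit_sym_aux[of h y] by (simp add: composition_rule)
    then have "inv h \<otimes> g \<in> stabilizer G \<phi> y"
      using that by (simp add: stabilizer_def)
    then have "inv h \<otimes> g = \<one>"
      using free that by blast
    then show ?thesis
      using that by (metis inv_inv inv_equality inv_closed)
  qed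
  \<comment> \<open>\<open>SOME\<close> depends only on the orbit as a set, so all points of an
    orbit get the same base point; \<open>z x\<close> will be the group element that carries it to
    \<open>x\<close>.\<close>
  define base where "base x = (SOME y. y \<in> orbit G \<phi> x)" for x
  have base_orbit: "base x \<in> orbit G \<phi> x" if "x \<in> E" for x
    unfolding base_def using orbit_refl[OF that] by (rule someI)
  have base_in: "base x \<in> E" if "x \<in> E" for x
    using base_orbit[OF that] element_image that by (auto simp: orbit_def)
  have base_translate: "base (\<phi> g x) = base x" if "g \<in> carrier G" "x \<in> E" for g x
  proof -
    have "orbit G \<phi> (\<phi> g x) = orbit G \<phi> x"
    proof (intro equalityI subsetI)
      fix y assume "y \<in> orbit G \<phi> (\<phi> g x)"
      then obtain h where h: "h \<in> carrier G" "y = \<phi> h (\<phi> g x)"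
        by (auto simp: orbit_def)
      then have "y = \<phi> (h \<otimes> g) x"
        using that by (simp add: composition_rule)
      then show "y \<in> orbit G \<phi> x"
        using that h by (auto simp: orbit_def)
    next
      fix y assume "y \<in> orbit G \<phi> x"
      then obtain h where h: "h \<in> carrier G" "y = \<phi> h x"
        by (auto simp: orbit_def)
      then have "y = \<phi> (h \<otimes> inv g) (\<phi> g x)"
        using that orbit_sym_aux[of g x] element_image[of g x]
        by (simp add: composition_rule)
      then show "y \<in> orbit G \<phi> (\<phi> g x)"
        using that h by (auto simp: orbit_def)
    qed
    then show ?thesis
      by (simp add: base_def)
  qed
  have ex: "\<exists>h. h \<in> carrier G \<and> \<phi> h (base x) = x" if "x \<in> E" for x
    using orbit_sym[OF that base_in[OF that] base_orbit[OF that]] by (auto simp: orbit_def)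
  then obtain z where z: "\<And>x. x \<in> E \<Longrightarrow> z x \<in> carrier G \<and> \<phi> (z x) (base x) = x"
    by metis
  \<comment> \<open>Both sides carry \<open>base x\<close> to \<open>\<phi> g x\<close>, so
    \<open>unique\<close> identifies them.\<close>
  have "z (\<phi> g x) = g \<otimes> z x" if "g \<in> carrier G" "x \<in> E" for g x
  proof (rule unique)
    have "\<phi> g x \<in> E"
      using element_image that by blast
    then show "z (\<phi> g x) \<in> carrier G" "\<phi> (z (\<phi> g x)) (base x) = \<phi> (g \<otimes> z x) (base x)"
      using z[of "\<phi> g x"] z[of x] that base_in
      by (simp_all add: base_translate composition_rule)
    show "g \<otimes> z x \<in> carrier G" "base x \<in> E"
      using z that base_in by simp_all
  qed
  with z that show thesis
    by blast
qed

section \<open>Copies of facets and the sites they lie at\<close>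

context weighted_complex
begin

lemma finite_facet_copies [simp]: "finite (facet_copies n \<Omega>)"
proof -
  have "facets n \<Omega> \<subseteq> Pow {..n}"
    by (auto simp: facets_def simplices_def)
  then show ?thesis
    by (auto simp: facet_copies_def intro: finite_subset)
qed

lemma facet_copy_exists: "F \<in> facets n \<Omega> \<Longrightarrow> (F, 0) \<in> facet_copies n \<Omega>"
  by (simp add: facet_copies_def facets_def simplices_def)

text \<open>Some maximal simplex contains the simplex \<open>{i}\<close>; its weight is nonzero, so
  its copy number 0 exists.\<close>

lemma facet_copies_at_nonempty:
  assumes "i \<le> n"
  shows "facet_copies_at n \<Omega> i \<noteq> {}"
proof -
  have "finite (simplices n \<Omega>)"
    by (rule finite_subset[of _ "Pow {..n}"]) (auto simp: simplices_def)
  moreover have "{i} \<in> simplices n \<Omega>"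
    using assms weight_vertex by (simp add: simplices_def)
  ultimately obtain F where "F \<in> simplices n \<Omega>" "{i} \<subseteq> F"
    "\<forall>S\<in>simplices n \<Omega>. F \<subseteq> S \<longrightarrow> F = S"
    using finite_has_maximal2[of "simplices n \<Omega>" "{i}"] by metis
  then have "(F, 0) \<in> facet_copies_at n \<Omega> i"
    using facet_copy_exists[of F] by (auto simp: facets_def facet_copies_at_def)
  then show ?thesis
    by blast
qed

text \<open>The empty set is not a facet, because it lies in the larger simplex \<open>{0}\<close>.
  Hence a labelling of the copies is determined by its restrictions to the sites.\<close>

lemma facet_copy_site:
  assumes "f \<in> facet_copies n \<Omega>"
  obtains i where "i \<le> n" "f \<in> facet_copies_at n \<Omega> i"
proof -
  have "fst f \<in> facets n \<Omega>"
    using assms by (auto simp: facet_copies_def)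
  moreover have "{0} \<in> simplices n \<Omega>"
    using weight_vertex by (simp add: simplices_def)
  ultimately have "fst f \<noteq> {}" "fst f \<subseteq> {..n}"
    by (auto simp: facets_def simplices_def)
  then show thesis
    using that assms by (auto simp: facet_copies_at_def)
qed

end

context complex_action
begin

lemma action_facet_copies_at:
  assumes "g \<in> carrier G" "i \<le> n" "f \<in> facet_copies_at n \<Omega> i"
  shows "\<psi> g f \<in> facet_copies_at n \<Omega> (\<phi> g i)"
proof -
  have f: "f \<in> facet_copies n \<Omega>" "i \<in> fst f"
    using assms by (simp_all add: facet_copies_at_def)
  then have "\<psi> g f \<in> facet_copies n \<Omega>"
    using facet.element_image[OF assms(1)] by blast
  then show ?thesis
    using f fst_equivariant[OF assms(1)] by (simp add: facet_copies_at_def)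
qed

lemma vertex_image [simp]: "g \<in> carrier G \<Longrightarrow> i \<le> n \<Longrightarrow> \<phi> g i \<le> n"
  using vertex.element_image by auto

end

text \<open>Freeness enters only through the equivariant map \<open>z\<close>. The injection
  \<open>enc\<close> codes pairs of a group element and a summand as naturals, since the rank is
  taken over index sets of naturals.\<close>

locale labelled_free_action = complex_action +
  fixes m :: "nat \<Rightarrow> nat" and p :: site_poly and r :: nat
    and P :: "nat \<Rightarrow> nat \<Rightarrow> site_poly"
    and z :: "nat set \<times> nat \<Rightarrow> 'a" and enc :: "'a \<times> nat \<Rightarrow> nat"
  assumes connected: "connected_complex n \<Omega>"
    and sizes: "\<And>g i. g \<in> carrier G \<Longrightarrow> i \<le> n \<Longrightarrow> m (\<phi> g i) = m i"
    and invariant: "invariant_poly G \<phi> p"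
    and P_local: "\<And>i j. i \<le> n \<Longrightarrow> j \<in> {1..r} \<Longrightarrow> P i j \<in> local_polys m i"
    and p_eq: "p = (\<Sum>j = 1..r. \<Prod>i\<le>n. P i j)"
    and z_closed: "\<And>f. f \<in> facet_copies n \<Omega> \<Longrightarrow> z f \<in> carrier G"
    and z_equivariant:
      "\<And>g f. g \<in> carrier G \<Longrightarrow> f \<in> facet_copies n \<Omega> \<Longrightarrow> z (\<psi> g f) = g \<otimes> z f"
    and enc_inj: "inj_on enc (carrier G \<times> {1..r})"
begin

sublocale group G
  using vertex.group_hom group_hom.axioms(1) by auto

section \<open>Labels, local polynomials and their behaviour under translation\<close>

definition labels :: "nat set" where
  "labels = enc ` (carrier G \<times> {1..r})"

definition matches :: "nat \<Rightarrow> (nat set \<times> nat \<Rightarrow> nat) \<Rightarrow> 'a \<Rightarrow> nat \<Rightarrow> bool" where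
  "matches i \<beta> w j \<longleftrightarrow> w \<in> carrier G \<and> j \<in> {1..r} \<and>
     (\<forall>f \<in> facet_copies_at n \<Omega> i. \<beta> f = enc (w \<otimes> z f, j))"

text \<open>The product of the weights of the \<open>n + 1\<close> sites is \<open>1 / |G|\<close>.\<close>

definition weight :: real where
  "weight = root (Suc n) (1 / real (order G))"

text \<open>A \<open>\<beta>\<close> matches at most one pair \<open>(w, j)\<close>, because every site lies in a facet.\<close>

definition local_poly :: "nat \<Rightarrow> (nat set \<times> nat \<Rightarrow> nat) \<Rightarrow> site_poly" where
  "local_poly i \<beta> =
     (if \<exists>w j. matches i \<beta> w j
      then let (w, j) = SOME (w, j). matches i \<beta> w j in Const weight * at_site i (P (\<phi> w i) j)
      else 0)"

text \<open>One common copy suffices: \<open>enc\<close> is injective and \<open>z f\<close>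
  cancels. The two sites may differ, so that neighbours can be compared too.\<close>

lemma matches_unique:
  assumes "matches i \<beta> w j" "matches i' \<beta>' w' j'" "\<beta> f = \<beta>' f"
    and "f \<in> facet_copies_at n \<Omega> i" "f \<in> facet_copies_at n \<Omega> i'"
  shows "w = w'" "j = j'"
proof -
  have "f \<in> facet_copies n \<Omega>"
    using assms by (simp add: facet_copies_at_def)
  moreover have "enc (w \<otimes> z f, j) = enc (w' \<otimes> z f, j')"
    using assms by (simp add: matches_def)
  moreover have "(w \<otimes> z f, j) \<in> carrier G \<times> {1..r}" "(w' \<otimes> z f, j') \<in> carrier G \<times> {1..r}"
    using assms z_closed[OF \<open>f \<in> facet_copies n \<Omega>\<close>] by (auto simp: matches_def)
  ultimately have "w \<otimes> z f = w' \<otimes> z f \<and> j = j'"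
    using inj_onD[OF enc_inj] by blast
  then show "w = w'" "j = j'"
    using assms z_closed[OF \<open>f \<in> facet_copies n \<Omega>\<close>] by (simp_all add: matches_def)
qed

lemma local_poly_matches:
  assumes "i \<le> n" "matches i \<beta> w j"
  shows "local_poly i \<beta> = Const weight * at_site i (P (\<phi> w i) j)"
proof -
  have "(SOME (w, j). matches i \<beta> w j) = (w, j)"
    using assms facet_copies_at_nonempty[OF assms(1)] matches_unique
    by (intro some_equality) blast+
  then show ?thesis
    using assms(2) by (auto simp: local_poly_def)
qed

lemma local_poly_no_match: "\<nexists>w j. matches i \<beta> w j \<Longrightarrow> local_poly i \<beta> = 0"
  by (simp add: local_poly_def)

lemma at_site_P_local:
  "w \<in> carrier G \<Longrightarrow> i \<le> n \<Longrightarrow> j \<in> {1..r} \<Longrightarrow> at_site i (P (\<phi> w i) j) \<in> local_polys m i"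
  by (rule at_site_local[OF P_local]) (simp_all add: sizes)

lemma local_poly_local:
  assumes "i \<le> n"
  shows "local_poly i \<beta> \<in> local_polys m i"
proof (cases "\<exists>w j. matches i \<beta> w j")
  case True
  then obtain w j where wj: "matches i \<beta> w j"
    by blast
  then have "at_site i (P (\<phi> w i) j) \<in> local_polys m i"
    using assms by (intro at_site_P_local) (auto simp: matches_def)
  then show ?thesis
    using assms wj
    by (simp add: local_poly_matches local_polys_def polys_in_mult polys_in_Const)
qed (simp add: local_poly_no_match local_polys_def)

text \<open>The map \<open>\<psi> g\<close> sends the copies at \<open>i\<close> onto those at
  \<open>\<phi> g i\<close>, and equivariance of \<open>z\<close> gives
  \<open>w \<otimes> z (\<psi> g f) = w \<otimes> g \<otimes> z f\<close>.\<close>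

lemma matches_translate:
  assumes "g \<in> carrier G" "i \<le> n"
  shows "matches (\<phi> g i) (translate n \<Omega> G \<phi> \<psi> i g \<beta>) w j \<longleftrightarrow>
    w \<in> carrier G \<and> matches i \<beta> (w \<otimes> g) j"
proof -
  let ?A = "facet_copies_at n \<Omega> i" and ?B = "facet_copies_at n \<Omega> (\<phi> g i)"
  have sub: "?A \<subseteq> facet_copies n \<Omega>"
    by (auto simp: facet_copies_at_def)
  have pull: "\<psi> (inv g) f \<in> ?A" if "f \<in> ?B" for f
    using action_facet_copies_at[of "inv g" "\<phi> g i" f] assms that
      vertex.orbit_sym_aux[OF assms(1), of i] by simp
  have "?B = \<psi> g ` ?A"
  proof (intro equalityI subsetI)
    fix f assume f: "f \<in> ?B"
    then have "f \<in> facet_copies n \<Omega>"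
      by (simp add: facet_copies_at_def)
    then have "f = \<psi> g (\<psi> (inv g) f)"
      using facet.orbit_sym_aux[of "inv g" f "\<psi> (inv g) f"] assms by simp
    then show "f \<in> \<psi> g ` ?A"
      using pull[OF f] by blast
  qed (use assms action_facet_copies_at in blast)
  moreover have "translate n \<Omega> G \<phi> \<psi> i g \<beta> (\<psi> g f) = \<beta> f" if "f \<in> ?A" for f
  proof -
    have "\<psi> (inv g) (\<psi> g f) = f"
      using that sub facet.orbit_sym_aux[OF assms(1)] by blast
    then show ?thesis
      using action_facet_copies_at[OF assms that] by (simp add: translate_def)
  qed
  ultimately have "(\<forall>f\<in>?B. translate n \<Omega> G \<phi> \<psi> i g \<beta> f = enc (w \<otimes> z f, j)) \<longleftrightarrow>
      (\<forall>f\<in>?A. \<beta> f = enc (w \<otimes> g \<otimes> z f, j))" if "w \<in> carrier G"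
    using that assms sub by (auto simp: z_equivariant z_closed m_assoc subset_iff)
  then show ?thesis
    using assms by (auto simp: matches_def)
qed

text \<open>A match \<open>(w, j)\<close> at \<open>i\<close> turns into the match
  \<open>(w \<otimes> inv g, j)\<close> at \<open>\<phi> g i\<close>. Both local polynomials are
  then taken from the same site \<open>\<phi> w i\<close>, and moving through
  \<open>\<phi> g i\<close> to \<open>i\<close> equals moving to \<open>i\<close> directly.\<close>

lemma local_poly_translate:
  assumes "g \<in> carrier G" "i \<le> n"
  shows "local_poly i \<beta> = at_site i (local_poly (\<phi> g i) (translate n \<Omega> G \<phi> \<psi> i g \<beta>))"
proof (cases "\<exists>w j. matches i \<beta> w j")
  case True
  then obtain w j where wj: "matches i \<beta> w j"
    by blast
  then have w: "w \<in> carrier G"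
    by (simp add: matches_def)
  have "w \<otimes> inv g \<otimes> g = w"
    using assms w by (simp add: m_assoc)
  then have "matches (\<phi> g i) (translate n \<Omega> G \<phi> \<psi> i g \<beta>) (w \<otimes> inv g) j"
    using assms w wj by (simp add: matches_translate)
  moreover have "\<phi> (w \<otimes> inv g) (\<phi> g i) = \<phi> w i"
    using assms w vertex.orbit_sym_aux[OF assms(1), of i] by (simp add: vertex.composition_rule)
  ultimately show ?thesis
    using assms wj by (simp add: local_poly_matches at_site_Const_mult at_site_at_site)
next
  case False
  \<comment> \<open>A match \<open>(w, j)\<close> of the translate would give the match
    \<open>(w \<otimes> g, j)\<close> of \<open>\<beta>\<close>.\<close>
  then have "\<nexists>w j. matches (\<phi> g i) (translate n \<Omega> G \<phi> \<psi> i g \<beta>) w j"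
    using assms by (simp add: matches_translate)
  then show ?thesis
    using False by (simp add: local_poly_no_match)
qed

section \<open>Summation over the global labellings\<close>

definition assignment :: "'a \<times> nat \<Rightarrow> nat set \<times> nat \<Rightarrow> nat" where
  "assignment = (\<lambda>(w, j). restrict (\<lambda>f. enc (w \<otimes> z f, j)) (facet_copies n \<Omega>))"

lemma matches_assignment:
  assumes "w \<in> carrier G" "j \<in> {1..r}"
  shows "matches i (restrict (assignment (w, j)) (facet_copies_at n \<Omega> i)) w j"
  using assms by (simp add: matches_def assignment_def facet_copies_at_def)

text \<open>The value at any copy at site 0 recovers the pair, so the reindexed sum counts every
  pair once.\<close>

lemma assignment_inj: "inj_on assignment (carrier G \<times> {1..r})"
proof (rule inj_onI, clarify)
  fix w w' j j'
  assume wj: "w \<in> carrier G" "j \<in> {1..r}" and wj': "w' \<in> carrier G" "j' \<in> {1..r}"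
    and eq: "assignment (w, j) = assignment (w', j')"
  obtain f where "f \<in> facet_copies_at n \<Omega> 0"
    using facet_copies_at_nonempty[of 0] by blast
  then show "w = w' \<and> j = j'"
    using matches_unique[OF matches_assignment[OF wj] matches_assignment[OF wj']] eq by metis
qed

text \<open>Neighbours share a copy of a facet, so \<open>matches_unique\<close> forces the same
  pair at both. Connectedness spreads the pair of site 0 to all sites, and every copy lies at some
  site.\<close>

lemma coherent:
  assumes "\<alpha> \<in> facet_copies n \<Omega> \<rightarrow>\<^sub>E labels"
    and ex: "\<And>i. i \<le> n \<Longrightarrow> \<exists>w j. matches i (restrict \<alpha> (facet_copies_at n \<Omega> i)) w j"
  shows "\<alpha> \<in> assignment ` (carrier G \<times> {1..r})"
proof -
  let ?\<alpha> = "\<lambda>i. restrict \<alpha> (facet_copies_at n \<Omega> i)"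
  obtain w j where start: "matches 0 (?\<alpha> 0) w j"
    using ex[of 0] by blast
  have all: "matches i (?\<alpha> i) w j" if "i \<le> n" for i
  proof -
    have "(neighbours n \<Omega>)\<^sup>*\<^sup>* 0 i"
      using connected that by (simp add: connected_complex_def)
    then show ?thesis
      using that
    proof (induction rule: rtranclp_induct)
      case base
      show ?case by (rule start)
    next
      case (step k l)
      then obtain F where F: "F \<in> facets n \<Omega>" "k \<in> F" "l \<in> F"
        by (auto simp: neighbours_def)
      then have "k \<le> n"
        by (auto simp: facets_def simplices_def)
      then have k: "matches k (?\<alpha> k) w j"
        by (rule step.IH)
      \<comment> \<open>Copy number 0 of the common facet links the two sites.\<close>
      have common: "(F, 0) \<in> facet_copies_at n \<Omega> k" "(F, 0) \<in> facet_copies_at n \<Omega> l"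
        using F facet_copy_exists by (simp_all add: facet_copies_at_def)
      obtain w' j' where l: "matches l (?\<alpha> l) w' j'"
        using ex step.prems by blast
      have "?\<alpha> k (F, 0) = ?\<alpha> l (F, 0)"
        using common by simp
      then show ?case
        using matches_unique[OF k l _ common] l by metis
    qed
  qed
  have "\<alpha> f = assignment (w, j) f" for f
  proof (cases "f \<in> facet_copies n \<Omega>")
    case True
    then obtain i where "i \<le> n" "f \<in> facet_copies_at n \<Omega> i"
      by (rule facet_copy_site)
    then show ?thesis
      using all[of i] True by (simp add: matches_def assignment_def)
  next
    case False
    then show ?thesis
      using PiE_arb[OF assms(1) False] by (simp add: assignment_def)
  qed
  then have "\<alpha> = assignment (w, j)"
    by blast
  then show ?thesis
    using start by (auto simp: matches_def)
qed

text \<open>For each summand, moving the polynomial of site \<open>\<phi> w i\<close> to site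
  \<open>i\<close> for all \<open>i\<close> amounts to acting with \<open>inv w\<close> on the
  product, and \<open>p\<close> is invariant.\<close>

lemma sum_shifted_products:
  assumes "w \<in> carrier G"
  shows "(\<Sum>j = 1..r. \<Prod>i\<le>n. at_site i (P (\<phi> w i) j)) = p"
proof -
  have bij: "bij_betw (\<phi> w) {..n} {..n}"
    using assms vertex.bij_prop0 by (auto simp: Bij_def)
  have "(\<Prod>i\<le>n. at_site i (P (\<phi> w i) j)) = poly_act \<phi> (inv w) (\<Prod>i\<le>n. P i j)"
    if j: "j \<in> {1..r}" for j
  proof -
    have "poly_act \<phi> (inv w) (\<Prod>i\<le>n. P i j) = (\<Prod>i\<le>n. poly_act \<phi> (inv w) (P i j))"
      by (simp add: poly_act_def rename_prod)
    also have "\<dots> = (\<Prod>i\<le>n. at_site (\<phi> (inv w) i) (P i j))"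
      using j by (intro prod.cong refl poly_act_local[OF P_local]) auto
    \<comment> \<open>The product is reindexed by the permutation \<open>\<phi> w\<close> of the
      sites.\<close>
    also have "\<dots> = (\<Prod>i\<le>n. at_site (\<phi> (inv w) (\<phi> w i)) (P (\<phi> w i) j))"
      by (rule prod.reindex_bij_betw[OF bij, symmetric])
    also have "\<dots> = (\<Prod>i\<le>n. at_site i (P (\<phi> w i) j))"
      using assms vertex.orbit_sym_aux[of w] by (intro prod.cong) auto
    finally show ?thesis ..
  qed
  then have "(\<Sum>j = 1..r. \<Prod>i\<le>n. at_site i (P (\<phi> w i) j)) =
      (\<Sum>j = 1..r. poly_act \<phi> (inv w) (\<Prod>i\<le>n. P i j))"
    by (rule sum.cong[OF refl])
  also have "\<dots> = poly_act \<phi> (inv w) p"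
    by (simp add: p_eq poly_act_def rename_sum)
  also have "\<dots> = p"
    using invariant assms by (simp add: invariant_poly_def)
  finally show ?thesis .
qed

lemma sum_assignments:
  "(\<Sum>\<alpha> \<in> facet_copies n \<Omega> \<rightarrow>\<^sub>E labels.
     \<Prod>i\<le>n. local_poly i (restrict \<alpha> (facet_copies_at n \<Omega> i))) = p"
proof -
  let ?L = "carrier G \<times> {1..r}"
  let ?term = "\<lambda>\<alpha>. \<Prod>i\<le>n. local_poly i (restrict \<alpha> (facet_copies_at n \<Omega> i))"
  have card: "real (order G) > 0"
    using finite_group order_gt_0_iff_finite by simp
  have fin: "finite (facet_copies n \<Omega> \<rightarrow>\<^sub>E labels)"
    using finite_group by (intro finite_PiE) (auto simp: labels_def)
  \<comment> \<open>By \<open>coherent\<close>, any other labelling fails to match at some site,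
    where its factor is zero.\<close>
  have "sum ?term (facet_copies n \<Omega> \<rightarrow>\<^sub>E labels) = sum ?term (assignment ` ?L)"
  proof (rule sum.mono_neutral_right[OF fin])
    show "assignment ` ?L \<subseteq> facet_copies n \<Omega> \<rightarrow>\<^sub>E labels"
      using z_closed by (auto simp: assignment_def labels_def)
    show "\<forall>\<alpha> \<in> (facet_copies n \<Omega> \<rightarrow>\<^sub>E labels) - assignment ` ?L. ?term \<alpha> = 0"
    proof
      fix \<alpha> assume "\<alpha> \<in> (facet_copies n \<Omega> \<rightarrow>\<^sub>E labels) - assignment ` ?L"
      then obtain i where "i \<le> n" "\<nexists>w j. matches i (restrict \<alpha> (facet_copies_at n \<Omega> i)) w j"
        using coherent by blast
      then show "?term \<alpha> = 0"
        by (intro prod_zero) (auto intro!: bexI[of _ i] local_poly_no_match)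
    qed
  qed
  also have "\<dots> = (\<Sum>x\<in>?L. ?term (assignment x))"
    by (subst sum.reindex[OF assignment_inj]) simp
  also have "\<dots> = (\<Sum>(w, j)\<in>?L. \<Prod>i\<le>n. Const weight * at_site i (P (\<phi> w i) j))"
    by (intro sum.cong prod.cong refl)
      (auto intro!: prod.cong local_poly_matches matches_assignment)
  \<comment> \<open>The \<open>n + 1\<close> factors \<open>weight\<close> multiply to
    \<open>1 / |G|\<close>.\<close>
  also have "\<dots> = (\<Sum>w\<in>carrier G. \<Sum>j = 1..r.
      Const (1 / real (order G)) * (\<Prod>i\<le>n. at_site i (P (\<phi> w i) j)))"
    using card by (simp add: sum.cartesian_product prod.distrib Const_power weight_def
        real_root_pow_pos2 del: power_Suc)
  \<comment> \<open>For each fixed \<open>w\<close> the inner sum is \<open>p / |G|\<close>,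
    independently of \<open>w\<close>.\<close>
  also have "\<dots> = of_nat (order G) * (Const (1 / real (order G)) * p)"
    by (simp add: sum_distrib_left[symmetric] sum_shifted_products order_def mult.left_commute
        del: One_nat_def)
  also have "\<dots> = p"
    using card by (simp add: of_nat_eq_Const mult.assoc[symmetric] Const_mult)
  finally show ?thesis .
qed

lemma decomposition: "invariant_decomposition n \<Omega> G \<phi> \<psi> m p labels local_poly"
  unfolding invariant_decomposition_def
  using local_poly_local local_poly_translate sum_assignments finite_group
  by (auto simp: labels_def)

text \<open>Without a match the multiple is taken with \<open>c = 0\<close>, but some
  \<open>j \<in> {1..r}\<close> must still exist. A value of \<open>\<beta>\<close> at a copy at
  site \<open>i\<close> is a label and provides one, which excludes \<open>r = 0\<close>.\<close>

lemma local_poly_multiple: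
  assumes "i \<le> n" "\<beta> \<in> facet_copies_at n \<Omega> i \<rightarrow>\<^sub>E labels"
  shows "\<exists>g \<in> carrier G. \<exists>j \<in> {1..r}. \<exists>c \<ge> 0. local_poly i \<beta> = Const c * at_site i (P (\<phi> g i) j)"
proof (cases "\<exists>w j. matches i \<beta> w j")
  case True
  then obtain w j where wj: "matches i \<beta> w j"
    by blast
  then have "w \<in> carrier G" "j \<in> {1..r}"
    by (simp_all add: matches_def)
  moreover have "weight \<ge> 0"
    by (simp add: weight_def)
  ultimately show ?thesis
    using local_poly_matches[OF assms(1) wj] by blast
next
  case False
  obtain f where "f \<in> facet_copies_at n \<Omega> i"
    using facet_copies_at_nonempty[OF assms(1)] by blast
  then have "\<beta> f \<in> labels"
    using assms(2) by auto
  then obtain g j where gj: "g \<in> carrier G" "j \<in> {1..r}"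
    by (auto simp: labels_def)
  have "local_poly i \<beta> = Const 0 * at_site i (P (\<phi> g i) j)"
    using local_poly_no_match[OF False] by (simp add: Const_def)
  then show ?thesis
    using gj by (meson order.refl)
qed

end

section \<open>Existence, finite rank and nonnegative multiples\<close>

theorem theorem15:
  fixes n :: nat and \<Omega> :: "nat set \<Rightarrow> nat" and G :: "('g, 'b) monoid_scheme"
    and \<phi> :: "'g \<Rightarrow> nat \<Rightarrow> nat" and \<psi> :: "'g \<Rightarrow> nat set \<times> nat \<Rightarrow> nat set \<times> nat"
    and m :: "nat \<Rightarrow> nat" and p :: site_poly
  assumes action: "complex_action n \<Omega> G \<phi> \<psi>"
    and connected: "connected_complex n \<Omega>"
    and sizes: "\<And>g i. g \<in> carrier G \<Longrightarrow> i \<le> n \<Longrightarrow> m (\<phi> g i) = m i"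
    and poly: "p \<in> global_polys n m"
    and invariant: "invariant_poly G \<phi> p"
    and free: "free_action n \<Omega> G \<psi>"
  shows "(\<exists>(I :: nat set) q. invariant_decomposition n \<Omega> G \<phi> \<psi> m p I q) \<and>
    decomposition_rank n \<Omega> G \<phi> \<psi> m p < \<infinity> \<and>
    (\<forall>(r :: nat) (f :: nat \<Rightarrow> nat \<Rightarrow> site_poly).
       (\<forall>i \<le> n. \<forall>j \<in> {1..r}. f i j \<in> local_polys m i) \<and>
       p = (\<Sum>j = 1..r. \<Prod>i\<le>n. f i j) \<longrightarrow>
       (\<exists>(I :: nat set) q. invariant_decomposition n \<Omega> G \<phi> \<psi> m p I q \<and>
          (\<forall>i \<le> n. \<forall>\<beta> \<in> facet_copies_at n \<Omega> i \<rightarrow>\<^sub>E I.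
             \<exists>g \<in> carrier G. \<exists>j \<in> {1..r}. \<exists>c \<ge> 0.
               q i \<beta> = Const c * at_site i (f (\<phi> g i) j))))"
proof -
  interpret complex_action n \<Omega> G \<phi> \<psi>
    by (rule action)
  have "\<And>x. x \<in> facet_copies n \<Omega> \<Longrightarrow> stabilizer G \<psi> x = {\<one>\<^bsub>G\<^esub>}"
    using free by (simp add: free_action_def)
  then obtain z where z: "\<And>x. x \<in> facet_copies n \<Omega> \<Longrightarrow> z x \<in> carrier G"
    "\<And>g x. g \<in> carrier G \<Longrightarrow> x \<in> facet_copies n \<Omega> \<Longrightarrow> z (\<psi> g x) = g \<otimes>\<^bsub>G\<^esub> z x"
    using facet.free_equivariant_map by metis
  have nonneg: "\<exists>(I :: nat set) q. invariant_decomposition n \<Omega> G \<phi> \<psi> m p I q \<and>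
      (\<forall>i \<le> n. \<forall>\<beta> \<in> facet_copies_at n \<Omega> i \<rightarrow>\<^sub>E I.
         \<exists>g \<in> carrier G. \<exists>j \<in> {1..r}. \<exists>c \<ge> 0. q i \<beta> = Const c * at_site i (f (\<phi> g i) j))"
    if f: "\<And>i j. i \<le> n \<Longrightarrow> j \<in> {1..r} \<Longrightarrow> f i j \<in> local_polys m i"
      and p: "p = (\<Sum>j = 1..r. \<Prod>i\<le>n. f i j)" for r and f :: "nat \<Rightarrow> nat \<Rightarrow> site_poly"
  proof -
    have "finite (carrier G \<times> {1..r})"
      using finite_group by simp
    from finite_imp_inj_to_nat_seg[OF this]
    obtain enc :: "'g \<times> nat \<Rightarrow> nat" where "inj_on enc (carrier G \<times> {1..r})"
      by metis
    then interpret labelled_free_action n \<Omega> G \<phi> \<psi> m p r f z enc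
      using connected sizes invariant f p z by unfold_locales
    show ?thesis
      using decomposition local_poly_multiple by blast
  qed
  \<comment> \<open>Existence is the case of \<open>nonneg\<close> for the splitting of
    \<open>p\<close> into monomials; the cardinality of the resulting index set bounds the
    rank.\<close>
  obtain r and f :: "nat \<Rightarrow> nat \<Rightarrow> site_poly" where
    "\<And>i j. i \<le> n \<Longrightarrow> f i j \<in> local_polys m i" "p = (\<Sum>j = 1..r. \<Prod>i\<le>n. f i j)"
    using global_poly_sum_of_products[OF poly] by blast
  then obtain I :: "nat set" and q where Iq: "invariant_decomposition n \<Omega> G \<phi> \<psi> m p I q"
    using nonneg by blast
  then have "decomposition_rank n \<Omega> G \<phi> \<psi> m p \<le> enat (card I)"
    unfolding decomposition_rank_def by (intro Inf_lower) blast
  then have "decomposition_rank n \<Omega> G \<phi> \<psi> m p < \<infinity>"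
    by (rule order.strict_trans1) simp
  then show ?thesis
    using Iq nonneg by blast
qed

end
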